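(* The critical occupation probability $p_c$ for oriented site percolation on the (two-dimensional) triangular lattice satisfies $p_c\ge 0.5730$.
   Context: Oriented site percolation on the triangular lattice: let $e_1=(1,0)$, $e_2=(0,1)$. Each site of $\mathbb{Z}^2$ is open with probability $p$ and closed with probability $1-p$, independently. Let $\mathbf{C}_x$ be the set of $y\in\mathbb{Z}^2$ for which there are $N\ge0$ and open sites $x=y_0,y_1,\dots,y_N=y$ with $y_{i+1}-y_i\in\{-e_1,e_2,e_2-e_1\}$ for all $0\le i\le N-1$. With $o$ the origin, $p_c=\inf\{p:\mathbb{P}(|\mathbf{C}_o|=\infty)>0\}$. *)

theory Defs
  imports "HOL-Probability.Probability"
begin

definition e1 :: "int \<times> int" where "e1 = (1, 0)"
definition e2 :: "int \<times> int" where "e2 = (0, 1)"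

(* A configuration maps a site to True if it is open. For p outside [0,1] bernoulli_pmf
   clamps its parameter, hence the explicit range of p in critical_prob. *)
definition site_measure :: "real \<Rightarrow> (int \<times> int \<Rightarrow> bool) measure" where
  "site_measure p = (\<Pi>\<^sub>M x\<in>UNIV. measure_pmf (bernoulli_pmf p))"

(* All sites of the path are open, both endpoints included; the cluster of a closed site
   is therefore empty. *)
definition cluster :: "(int \<times> int \<Rightarrow> bool) \<Rightarrow> int \<times> int \<Rightarrow> (int \<times> int) set" where
  "cluster \<omega> x = {y. \<exists>(N::nat) \<gamma>. \<gamma> 0 = x \<and> \<gamma> N = y \<and> (\<forall>i\<le>N. \<omega> (\<gamma> i)) \<and>
     (\<forall>i<N. \<gamma> (Suc i) - \<gamma> i \<in> {- e1, e2, e2 - e1})}"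

definition critical_prob :: real where
  "critical_prob =
     Inf {p. 0 \<le> p \<and> p \<le> 1 \<and> \<P>(\<omega> in site_measure p. infinite (cluster \<omega> (0, 0))) > 0}"

end

theory Submission
  imports Defs "HOL-Real_Asymp.Real_Asymp"
begin

text \<open>After the reflection \<open>x \<mapsto> - x\<close> the steps are \<open>(1, 0)\<close>, \<open>(0, 1)\<close>, \<open>(1, 1)\<close>. Reveal the cluster of the
  origin row by row and follow the right edge of its intersection with each row. Forgetting all but
  the five sites to the left of the edge, by declaring every site further left occupied, can only
  enlarge the cluster and leaves a finite Markov chain seen from the edge. An explicit potential
  \<open>z\<^sup>x h\<close> of the edge position \<open>x\<close> and the window shrinks in expectation, relative to the diagonal,
  by a factor \<open>\<kappa> < 1\<close> per row when \<open>p = 587/1024 > 0.573\<close>. Hence a site \<open>(x, y)\<close> with \<open>y \<le> x\<close> is reached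
  with probability at most \<open>2 \<kappa>\<^sup>x\<close>, for this and, by monotonicity, for every smaller \<open>p\<close>. Exchanging the
  two coordinates covers \<open>x \<le> y\<close>, and Borel-Cantelli shows that the cluster is almost surely finite.\<close>

subsection \<open>Exploring the rows\<close>

datatype tree = Lf int | Nd tree tree

fun look :: "tree \<Rightarrow> bool list \<Rightarrow> int" where
  "look (Lf c) l = c"
| "look (Nd s t) [] = look t []"
| "look (Nd s t) (b # l) = (if b then look t l else look s l)"

fun depth :: "tree \<Rightarrow> nat" where
  "depth (Lf c) = 0"
| "depth (Nd s t) = Suc (max (depth s) (depth t))"

text \<open>Sites beyond the end of a list count as occupied, so shortening a list only enlarges the set
  of occupied sites.\<close>

fun pad :: "nat \<Rightarrow> bool list \<Rightarrow> bool list" where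
  "pad 0 l = []"
| "pad (Suc k) [] = True # pad k []"
| "pad (Suc k) (b # l) = b # pad k l"

lemma length_pad [simp]: "length (pad k l) = k"
  by (induction k l rule: pad.induct) auto

lemma look_pad: "depth t \<le> k \<Longrightarrow> look t (pad k l) = look t l"
proof (induction t l arbitrary: k rule: look.induct)
  case (2 s t)
  then show ?case by (cases k) auto
next
  case (3 s t b l)
  then show ?case by (cases k) auto
qed auto

definition hd1 :: "bool list \<Rightarrow> bool" where
  "hd1 l = (case l of [] \<Rightarrow> True | b # _ \<Rightarrow> b)"

lemma hd1_simps [simp]: "hd1 []" "hd1 (b # l) = b"
  by (simp_all add: hd1_def)

text \<open>A row is described by its rightmost relevant position \<open>r\<close> and the list of the states of
  \<open>r, r - 1, \<dots>\<close>.\<close>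

fun occ :: "int \<Rightarrow> bool list \<Rightarrow> int set" where
  "occ r [] = {..r}"
| "occ r (b # l) = occ (r - 1) l \<union> (if b then {r} else {})"

lemma occ_le: "u \<in> occ r l \<Longrightarrow> u \<le> r"
  by (induction r l rule: occ.induct) (auto split: if_splits)

lemma occ_hd1: "r \<in> occ r l \<longleftrightarrow> hd1 l"
  by (cases l) (auto dest: occ_le)

lemma occ_pad: "occ r l \<subseteq> occ r (pad k l)"
proof (induction k l arbitrary: r rule: pad.induct)
  case (1 l)
  then show ?case by (auto dest: occ_le)
next
  case (2 k)
  have "{..r} \<subseteq> insert r (occ (r - 1) [])" by auto
  then show ?case using 2[of "r - 1"] by auto
next
  case (3 k b l)
  then show ?case by fastforce
qed

text \<open>The disjuncts are the steps \<open>(0, 1)\<close> and \<open>(1, 1)\<close> from the old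
  row and \<open>(1, 0)\<close> within the new one. Past the end of a list \<open>hd1\<close>
  defaults to occupied, in agreement with \<open>occ\<close>.\<close>

fun next_row :: "(int \<Rightarrow> bool) \<Rightarrow> int \<Rightarrow> bool list \<Rightarrow> bool list" where
  "next_row g r [] = []"
| "next_row g r (b # l) =
     (let n = next_row g (r - 1) l in (g r \<and> (b \<or> hd1 l \<or> hd1 n)) # n)"

lemma length_next_row [simp]: "length (next_row g r l) = length l"
  by (induction g r l rule: next_row.induct) (auto simp: Let_def)

lemma next_row_cong:
  "(\<And>u. u \<le> r \<Longrightarrow> g u = g' u) \<Longrightarrow> next_row g r l = next_row g' r l"
  by (induction g r l rule: next_row.induct) (auto simp: Let_def)

lemma next_row_closed:
  assumes "u \<le> r" "g u" "u \<in> occ r l \<or> u - 1 \<in> occ r l \<or> u - 1 \<in> occ r (next_row g r l)"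
  shows "u \<in> occ r (next_row g r l)"
  using assms
proof (induction g r l rule: next_row.induct)
  case (2 g r b l)
  let ?n = "next_row g (r - 1) l"
  show ?case
  proof (cases "u = r")
    case True
    have "r - 1 \<in> occ r (c # m) \<longleftrightarrow> hd1 m" for c m
      using occ_hd1[of "r - 1" m] by auto
    moreover have "r \<in> occ r (c # m) \<longleftrightarrow> c" for c m
      using occ_hd1[of r "c # m"] by simp
    ultimately show ?thesis using True 2(3,4) by (simp add: Let_def)
  next
    case False
    then have "u - 1 \<noteq> r" "u \<noteq> r" "u \<le> r - 1" using 2(2) by auto
    then show ?thesis using 2(1) 2(3,4) by (auto simp: Let_def split: if_splits)
  qed
qed auto

text \<open>The fuel \<open>k\<close> caps the run of open sites, so that finitely many sites of a
  row are inspected.\<close>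

fun extend :: "(int \<Rightarrow> bool) \<Rightarrow> nat \<Rightarrow> int \<Rightarrow> bool list \<Rightarrow> int \<times> bool list" where
  "extend g 0 x n = (x, n)"
| "extend g (Suc k) x n =
     (if hd1 n \<and> g (x + 1) then extend g k (x + 1) (True # n) else (x, n))"

lemma extend_occ_le:
  "u \<le> x \<Longrightarrow> u \<in> case_prod occ (extend g k x n) \<longleftrightarrow> u \<in> occ x n"
  by (induction g k x n rule: extend.induct) auto

lemma extend_closed:
  assumes "u - 1 \<in> case_prod occ (extend g k x n)" "x < u" "u \<le> x + int k" "g u"
  shows "u \<in> case_prod occ (extend g k x n)"
  using assms
proof (induction g k x n rule: extend.induct)
  case (2 g k x n)
  show ?case
  proof (cases "hd1 n \<and> g (x + 1)")
    case True
    show ?thesis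
    proof (cases "u = x + 1")
      case u: True
      have "x + 1 \<in> occ (x + 1) (True # n)" by simp
      then show ?thesis
        using True u extend_occ_le[of u "x + 1" g k "True # n"] by auto
    next
      case False
      then show ?thesis using 2 True by auto
    qed
  next
    case False
    then have *: "u - 1 \<in> occ x n" using 2(2) by auto
    then have "u = x + 1" using occ_le[OF *] 2(3) by simp
    then show ?thesis using False * occ_hd1[of x n] 2(5) by auto
  qed
qed auto

fun strip :: "int \<Rightarrow> bool list \<Rightarrow> int \<times> bool list" where
  "strip x [] = (x, [])"
| "strip x (b # l) = (if b then (x, b # l) else strip (x - 1) l)"

lemma occ_strip: "case_prod occ (strip x l) = occ x l"
  by (induction x l rule: strip.induct) auto

lemma hd1_strip: "hd1 (snd (strip x l))"
  by (induction x l rule: strip.induct) auto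

lemma strip_bounds: "fst (strip x l) \<le> x" "x - int (length l) \<le> fst (strip x l)"
  by (induction x l rule: strip.induct) auto

text \<open>Six entries: the occupied edge and the five sites behind it.\<close>

definition trim :: "int \<times> bool list \<Rightarrow> int \<times> bool list" where
  "trim = (\<lambda>(x, n). case strip x n of (x', l) \<Rightarrow> (x', pad 6 l))"

text \<open>For states with \<open>hd1 l\<close>, site \<open>r + 1\<close> is reached diagonally
  from the old edge, so openness alone decides it. Beyond it the run is followed only up to
  \<open>B\<close>.\<close>

definition advance :: "(int \<Rightarrow> bool) \<Rightarrow> int \<Rightarrow> int \<times> bool list \<Rightarrow> int \<times> bool list" where
  "advance g B = (\<lambda>(r, l). let n = next_row g r l in
     if g (r + 1) then extend g (nat (B - (r + 1))) (r + 1) (True # n) else (r, n))"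

lemma occ_trim: "case_prod occ s \<subseteq> case_prod occ (trim s)"
proof (cases s)
  case (Pair x n)
  obtain x' l where *: "strip x n = (x', l)" by force
  have "occ x n = occ x' l" using occ_strip[of x n] * by simp
  then show ?thesis using Pair * occ_pad[of x' l 6] by (simp add: trim_def)
qed

lemma hd1_pad [simp]: "0 < k \<Longrightarrow> hd1 (pad k l) = hd1 l"
  by (cases k; cases l) auto

lemma hd1_trim: "hd1 (snd (trim s))"
  by (auto simp: trim_def split: prod.splits) (metis hd1_strip snd_conv)

lemma length_trim [simp]: "length (snd (trim s)) = 6"
  by (auto simp: trim_def split: prod.splits)

lemma advance_closed:
  assumes l: "hd1 l" and u: "u \<le> B" "g u"
    and nb: "u \<in> occ r l \<or> u - 1 \<in> occ r l \<or> u - 1 \<in> case_prod occ (advance g B (r, l))"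
  shows "u \<in> case_prod occ (advance g B (r, l))"
proof -
  define n where "n = next_row g r l"
  define k where "k = nat (B - (r + 1))"
  have adv: "advance g B (r, l) = (if g (r + 1) then extend g k (r + 1) (True # n) else (r, n))"
    by (simp add: advance_def n_def k_def Let_def)
  have low: "v \<in> case_prod occ (advance g B (r, l)) \<longleftrightarrow> v \<in> occ r n" if "v \<le> r" for v
    using that extend_occ_le[of v "r + 1" g k "True # n"] by (auto simp: adv)
  consider "u \<le> r" | "u = r + 1" | "u > r + 1" by linarith
  then show ?thesis
  proof cases
    case 1
    then show ?thesis using next_row_closed[of u r g l] u nb low[of u] low[of "u - 1"]
      unfolding n_def by auto
  next
    case 2
    then show ?thesis using u extend_occ_le[of u "r + 1" g k "True # n"] by (auto simp: adv)
  next
    case 3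
    then have "u \<notin> occ r l" "u - 1 \<notin> occ r l" by (auto dest: occ_le)
    with nb have *: "u - 1 \<in> case_prod occ (advance g B (r, l))" by simp
    show ?thesis
    proof (cases "g (r + 1)")
      case True
      then show ?thesis using * 3 u extend_closed[of u g k "r + 1" "True # n"]
        by (simp add: adv k_def)
    next
      case False
      then show ?thesis using * 3 by (auto simp: adv dest: occ_le)
    qed
  qed
qed

text \<open>The state at \<open>y\<close> describes row \<open>y - 1\<close>, before row
  \<open>y\<close> is revealed. The start is a fictitious occupied half-line below row 0, which can
  only enlarge the cluster.\<close>

fun explore :: "(int \<times> int \<Rightarrow> bool) \<Rightarrow> int \<Rightarrow> nat \<Rightarrow> int \<times> bool list" where
  "explore \<omega> B 0 = (0, pad 6 [])"
| "explore \<omega> B (Suc y) = trim (advance (\<lambda>x. \<omega> (x, int y)) B (explore \<omega> B y))"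

lemma hd1_explore: "hd1 (snd (explore \<omega> B y))"
  by (cases y) (simp_all add: hd1_trim)

lemma length_explore: "length (snd (explore \<omega> B y)) = 6"
  by (cases y) simp_all

text \<open>The mirror image \<open>(x, y) \<mapsto> (- x, y)\<close> of the lattice.\<close>

fun reach :: "nat \<Rightarrow> (int \<times> int \<Rightarrow> bool) \<Rightarrow> int \<times> int \<Rightarrow> bool" where
  "reach 0 \<omega> v \<longleftrightarrow> v = (0, 0) \<and> \<omega> v"
| "reach (Suc N) \<omega> v \<longleftrightarrow> \<omega> v \<and> (\<exists>d\<in>{(1, 0), (0, 1), (1, 1)}. reach N \<omega> (v - d))"

lemma reach_nonneg: "reach N \<omega> v \<Longrightarrow> 0 \<le> fst v \<and> 0 \<le> snd v"
  by (induction N arbitrary: v) force+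

lemma reach_mono: "reach N \<omega> v \<Longrightarrow> \<omega> \<le> \<omega>' \<Longrightarrow> reach N \<omega>' v"
  by (induction N arbitrary: v) (auto simp: le_fun_def)

text \<open>The explored rows dominate the true cluster up to column \<open>B\<close>. Induction is
  on the path length, since the last step may stay within the row.\<close>

lemma reach_explored:
  assumes "reach N \<omega> (u, int y)" "u \<le> B"
  shows "u \<in> case_prod occ (advance (\<lambda>x. \<omega> (x, int y)) B (explore \<omega> B y))"
  using assms
proof (induction N arbitrary: u y)
  case 0
  then have "u = 0" "y = 0" "\<omega> (0, 0)" by auto
  moreover have "0 \<in> occ 0 (pad 6 [])"
    by (simp add: occ_hd1)
  ultimately show ?case
    using advance_closed[of "pad 6 []" 0 B "\<lambda>x. \<omega> (x, 0)" 0] 0 by simp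
next
  case (Suc N)
  obtain r l where s: "explore \<omega> B y = (r, l)" by force
  have l: "hd1 l" using hd1_explore[of \<omega> B y] s by simp
  have \<omega>: "\<omega> (u, int y)" using Suc by simp
  \<comment> \<open>A predecessor in the row below forces \<open>y\<close> to be positive, so that
    row was explored, and trimming only enlarged it.\<close>
  have old: "v \<in> occ r l" if "reach N \<omega> (v, int y - 1)" "v \<le> B" for v
  proof -
    have "0 \<le> int y - 1" using reach_nonneg[OF that(1)] by simp
    then obtain z where z: "y = Suc z" by (cases y) auto
    then have "v \<in> case_prod occ (advance (\<lambda>x. \<omega> (x, int z)) B (explore \<omega> B z))"
      using Suc.IH[of v z] that by simp
    then show ?thesis
      using occ_trim[of "advance (\<lambda>x. \<omega> (x, int z)) B (explore \<omega> B z)"] s z by auto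
  qed
  have "reach N \<omega> (u - 1, int y) \<or> reach N \<omega> (u, int y - 1) \<or> reach N \<omega> (u - 1, int y - 1)"
    using Suc.prems by auto
  then have "u \<in> occ r l \<or> u - 1 \<in> occ r l \<or>
      u - 1 \<in> case_prod occ (advance (\<lambda>x. \<omega> (x, int y)) B (r, l))"
    using old Suc.IH[of "u - 1" y] Suc.prems(2) s by auto
  then show ?case
    unfolding s by (intro advance_closed) (use l Suc.prems \<omega> in auto)
qed

subsection \<open>The potential\<close>

text \<open>Both trees were computed numerically, scaled by \<open>10\<^sup>6\<close> and rounded: \<open>weights\<close>
  approximates the leading eigenvector, at \<open>p = 587/1024\<close>, of the one-row transfer operator
  weighted by \<open>z\<^sup>x\<close> with \<open>z = 256/255\<close>, where \<open>x\<close> is the displacement of the right edge.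
  \<open>run_weights\<close> bounds the expected weight while the run of open sites at the right end of the
  new row is still being revealed.\<close>

definition weights :: tree where
  "weights = Nd (Nd (Nd (Nd (Nd (Lf 997157) (Lf 997886)) (Lf 998683)) (Nd (Nd (Lf 999311) (Lf 999425))
    (Lf 999425))) (Nd (Nd (Nd (Lf 999644) (Lf 999834)) (Lf 1000000)) (Nd (Nd (Lf 999924) (Lf
    1000000)) (Lf 1000000)))) (Nd (Nd (Nd (Nd (Lf 998906) (Lf 999293)) (Lf 999687)) (Nd (Nd (Lf
    999924) (Lf 1000000)) (Lf 1000000))) (Nd (Nd (Nd (Lf 999644) (Lf 999834)) (Lf 1000000)) (Nd
    (Nd (Lf 999924) (Lf 1000000)) (Lf 1000000))))"

definition run_weights :: tree where
  "run_weights = Nd (Nd (Nd (Nd (Nd (Lf 1003760) (Lf 1004071)) (Lf 1004506)) (Nd (Nd (Lf 1004897) (Lf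
    1004946)) (Lf 1004946))) (Nd (Nd (Nd (Lf 1005127) (Lf 1005209)) (Lf 1005298)) (Nd (Nd (Lf
    1005266) (Lf 1005298)) (Lf 1005298)))) (Nd (Nd (Nd (Nd (Lf 1004733) (Lf 1004898)) (Lf
    1005113)) (Nd (Nd (Lf 1005266) (Lf 1005298)) (Lf 1005298))) (Nd (Nd (Nd (Lf 1005127) (Lf
    1005209)) (Lf 1005298)) (Nd (Nd (Lf 1005266) (Lf 1005298)) (Lf 1005298))))"

text \<open>The weights \<open>a\<close>, \<open>b\<close> need not add up to 1: this lets the same recursion run on integers.\<close>

fun row_exp :: "'a \<Rightarrow> 'a \<Rightarrow> bool list \<Rightarrow> (bool list \<Rightarrow> 'a) \<Rightarrow> 'a::comm_ring_1" where
  "row_exp a b [] f = f []"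
| "row_exp a b (c # l) f = row_exp a b l (\<lambda>n.
     if c \<or> hd1 l \<or> hd1 n then a * f (True # n) + b * f (False # n) else (a + b) * f (False # n))"

text \<open>Integer versions of \<open>pot\<close> and \<open>final\<close> below, with all denominators cleared.\<close>

fun int_pot :: "nat \<Rightarrow> bool list \<Rightarrow> int" where
  "int_pot j [] = 256 ^ j * look weights []"
| "int_pot 0 (b # l) = look weights l"
| "int_pot (Suc j) (b # l) = (if b then 256 ^ Suc j * look weights l else 255 * int_pot j l)"

definition int_final :: "bool list \<Rightarrow> int" where
  "int_final n = 587 * (256 ^ 7 * look run_weights n) + 437 * (255 * int_pot 6 n)"

text \<open>The factor \<open>1024 ^ 7\<close> comes from the six sites of the window and site
  \<open>r + 1\<close>; \<open>256 ^ 7\<close> clears the at most seven unit shifts by which the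
  edge can fall short of \<open>r + 1\<close>.\<close>

lemma row_certificate:
  "\<forall>l\<in>set (List.n_lists 5 [True, False]).
     32768 * row_exp 587 437 (True # l) int_final \<le> 32767 * (1024 ^ 7 * 256 ^ 7 * look weights l)"
  by code_simp

text \<open>\<open>run_weights\<close> is a supersolution for the run: a closed site ends it with
  value \<open>weights\<close>, an open one gains a factor \<open>256 / 255\<close>. The first
  inequality serves a run cut off by the cap.\<close>

lemma run_certificate:
  "\<forall>l\<in>set (List.n_lists 5 [True, False]). look weights l \<le> look run_weights l \<and>
     587 * 256 * look run_weights (True # l) + 437 * 255 * look weights l
       \<le> 1024 * 255 * look run_weights l"
  by code_simp

abbreviation p0 :: real where "p0 \<equiv> 587 / 1024"

text \<open>The potential of a row not yet trimmed: each closed leading site moves the edge one step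
  left and costs a factor \<open>255 / 256\<close>.\<close>

fun pot :: "bool list \<Rightarrow> real" where
  "pot [] = real_of_int (look weights [])"
| "pot (b # l) = (if b then real_of_int (look weights l) else 255 / 256 * pot l)"

text \<open>Average over the state of site \<open>r + 1\<close>, normalized by the power of
  \<open>256 / 255\<close> at \<open>r + 1\<close>; hence the extra factor if that site is
  closed.\<close>

definition final :: "bool list \<Rightarrow> real" where
  "final n = p0 * real_of_int (look run_weights n) + (1 - p0) * (255 / 256 * pot n)"

lemma int_pot_eq: "length l \<le> j \<Longrightarrow> real_of_int (int_pot j l) = 256 ^ j * pot l"
  by (induction j l rule: int_pot.induct) auto

lemma int_final_eq: "length n \<le> 6 \<Longrightarrow> real_of_int (int_final n) = 1024 * 256 ^ 7 * final n"
  by (simp add: int_final_def final_def int_pot_eq algebra_simps)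

section \<open>Linearity and scaling of the row expectation\<close>

lemma row_exp_cong:
  "(\<And>n. length n = length l \<Longrightarrow> f n = g n) \<Longrightarrow> row_exp a b l f = row_exp a b l g"
proof (induction l arbitrary: f g)
  case (Cons c l)
  show ?case
    unfolding row_exp.simps by (rule Cons.IH) (simp add: Cons.prems)
qed simp

lemma row_exp_cmult: "row_exp a b l (\<lambda>n. c * f n) = c * row_exp a b l f"
proof (induction l arbitrary: f)
  case (Cons d l)
  show ?case
    unfolding row_exp.simps Cons.IH[symmetric]
    by (rule row_exp_cong) (simp add: algebra_simps)
qed simp

lemma row_exp_scale: "row_exp (c * a) (c * b) l f = c ^ length l * row_exp a b l f"
proof (induction l arbitrary: f)
  case (Cons d l)
  show ?case
    unfolding row_exp.simps Cons.IH length_Cons power_Suc2 mult.assoc row_exp_cmult[symmetric]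
    by (intro arg_cong[where f = "(*) _"] row_exp_cong) (simp add: algebra_simps)
qed simp

lemma of_int_row_exp:
  "real_of_int (row_exp a b l f) = row_exp (real_of_int a) (real_of_int b) l (\<lambda>n. real_of_int (f n))"
proof (induction l arbitrary: f)
  case (Cons d l)
  show ?case
    unfolding row_exp.simps Cons.IH by (rule row_exp_cong) simp
qed simp

lemma row_exp_final:
  assumes "length l = 5"
  shows "row_exp p0 (1 - p0) (True # l) final \<le> 32767 / 32768 * real_of_int (look weights l)"
proof -
  have "l \<in> set (List.n_lists 5 [True, False])"
    using assms by (auto simp: set_n_lists)
  then have "real_of_int (32768 * row_exp 587 437 (True # l) int_final)
      \<le> real_of_int (32767 * (1024 ^ 7 * 256 ^ 7 * look weights l))"
    using row_certificate of_int_le_iff by blast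
  moreover have "real_of_int (row_exp 587 437 (True # l) int_final)
      = row_exp (1024 * p0) (1024 * (1 - p0)) (True # l) (\<lambda>n. real_of_int (int_final n))"
    by (simp only: of_int_row_exp) (simp add: Let_def)
  \<comment> \<open>The six revealed sites contribute \<open>1024 ^ 6\<close>; the seventh factor
    sits in \<open>int_final\<close>.\<close>
  moreover have "\<dots> = 1024 ^ 6 * row_exp p0 (1 - p0) (True # l) (\<lambda>n. 1024 * 256 ^ 7 * final n)"
    unfolding row_exp_scale using assms
    by (simp del: row_exp.simps add: row_exp_cong[of "True # l" "\<lambda>n. real_of_int (int_final n)"
        "\<lambda>n. 1024 * 256 ^ 7 * final n"] int_final_eq)
  ultimately show ?thesis
    by (simp del: row_exp.simps add: row_exp_cmult)
qed

text \<open>Both trees have depth 5, so padding to five entries reduces any list to one of the 32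
  certified windows.\<close>

lemma look_run:
  shows "look weights n \<le> look run_weights n"
    and "p0 * (256 / 255) * real_of_int (look run_weights (True # n)) + (1 - p0) * real_of_int (look weights n)
      \<le> real_of_int (look run_weights n)"
proof -
  have "depth weights = 5" "depth run_weights = 5"
    by (simp_all add: weights_def run_weights_def)
  then have eq: "look weights (pad 5 n) = look weights n" "look run_weights (pad 5 n) = look run_weights n"
    "look run_weights (True # pad 5 n) = look run_weights (True # n)"
    using look_pad[of weights 5 n] look_pad[of run_weights 5 n] look_pad[of run_weights 6 "True # n"]
      pad.simps(3)[of 5 True n] by simp_all
  have "pad 5 n \<in> set (List.n_lists 5 [True, False])"
    by (auto simp: set_n_lists)
  then have "look weights n \<le> look run_weights n"
    and *: "587 * 256 * look run_weights (True # n) + 437 * 255 * look weights n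
       \<le> 1024 * 255 * look run_weights n"
    using run_certificate eq by fastforce+
  show "look weights n \<le> look run_weights n" by fact
  from * have "real_of_int (587 * 256 * look run_weights (True # n) + 437 * 255 * look weights n)
       \<le> real_of_int (1024 * 255 * look run_weights n)"
    using of_int_le_iff by blast
  then show "p0 * (256 / 255) * real_of_int (look run_weights (True # n)) + (1 - p0) * real_of_int (look weights n)
      \<le> real_of_int (look run_weights n)" by (simp add: field_simps)
qed

lemma pot_pad: 
  assumes "hd1 l"
  shows "pot (pad 6 l) = pot l"
proof -
  have "look weights (pad 5 m) = look weights m" for m
    by (rule look_pad) (simp add: weights_def)
  then show ?thesis
    using assms pad.simps(2)[of 5] pad.simps(3)[of 5] weights_def by (cases l) auto
qed

definition val :: "int \<times> bool list \<Rightarrow> real" where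
  "val = (\<lambda>(x, l). (256 / 255) powi x * pot l)"

text \<open>Dropping a closed leading site trades a factor \<open>255 / 256\<close> in
  \<open>pot\<close> for a shift of the edge, and \<open>weights\<close> sees only the five sites
  kept behind the edge.\<close>

lemma val_trim: "val (trim s) = val s"
proof -
  have "val (strip x l) = val (x, l)" for x l
    by (induction x l rule: strip.induct) (auto simp: val_def power_int_diff field_simps)
  moreover have "val (x, pad 6 l) = val (x, l)" if "hd1 l" for x l
    using pot_pad[OF that] by (simp add: val_def)
  ultimately show ?thesis
    by (cases s) (auto simp: trim_def split: prod.splits, metis hd1_strip snd_conv)
qed

lemma weights_bounds: "997157 \<le> look weights l" "look weights l \<le> 1000000"
proof -
  have "depth weights = 5" by (simp add: weights_def)
  then have eq: "look weights (pad 5 l) = look weights l"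
    using look_pad[of weights 5 l] by simp
  have "pad 5 l \<in> set (List.n_lists 5 [True, False])"
    by (auto simp: set_n_lists)
  moreover have "\<forall>l\<in>set (List.n_lists 5 [True, False]). 997157 \<le> look weights l \<and> look weights l \<le> 1000000"
    by code_simp
  ultimately show "997157 \<le> look weights l" "look weights l \<le> 1000000"
    using eq by fastforce+
qed

lemma pot_pos: "0 < pot l"
  using weights_bounds(1) by (induction l rule: pot.induct) (auto simp: order_less_le_trans[of 0 997157])

subsection \<open>Resampling finitely many sites\<close>

text \<open>A conditional expectation as a finite sum: the listed sites are drawn afresh, all others
  are kept from \<open>w\<close>. Bounds in this form avoid integrability questions and can be made
  uniform in \<open>w\<close>.\<close>

fun resample :: "real \<Rightarrow> 'a list \<Rightarrow> (('a \<Rightarrow> bool) \<Rightarrow> real) \<Rightarrow> ('a \<Rightarrow> bool) \<Rightarrow> real" where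
  "resample p [] F w = F w"
| "resample p (v # vs) F w = p * resample p vs F (w(v := True)) + (1 - p) * resample p vs F (w(v := False))"

lemma resample_append: "resample p (xs @ ys) F w = resample p xs (resample p ys F) w"
  by (induction xs arbitrary: w) auto

lemma resample_cong:
  "(\<And>w'. (\<And>v. v \<notin> set xs \<Longrightarrow> w' v = w v) \<Longrightarrow> F w' = G w') \<Longrightarrow> resample p xs F w = resample p xs G w"
proof (induction xs arbitrary: w)
  case (Cons v vs)
  have "resample p vs F (w(v := b)) = resample p vs G (w(v := b))" for b
    by (intro Cons.IH Cons.prems) auto
  then show ?case by simp
qed simp

lemma resample_const [simp]: "resample p xs (\<lambda>_. c) w = c"
  by (induction xs arbitrary: w) (auto simp: algebra_simps)

lemma resample_cmult: "resample p xs (\<lambda>w. c * F w) w = c * resample p xs F w"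
  by (induction xs arbitrary: w) (auto simp: algebra_simps)

lemma resample_map:
  assumes "inj \<phi>"
  shows "resample p (map \<phi> xs) (\<lambda>w. F (w \<circ> \<phi>)) w = resample p xs F (w \<circ> \<phi>)"
proof -
  have "w(\<phi> v := b) \<circ> \<phi> = (w \<circ> \<phi>)(v := b)" for w :: "'b \<Rightarrow> bool" and v b
    using assms by (auto simp: fun_eq_iff inj_def)
  then show ?thesis by (induction xs arbitrary: w) simp_all
qed

context
  fixes p :: real
  assumes p: "0 \<le> p" "p \<le> 1"
begin

lemma resample_mono: "(\<And>w. F w \<le> G w) \<Longrightarrow> resample p xs F w \<le> resample p xs G w"
  using p by (induction xs arbitrary: w) (auto intro!: add_mono mult_left_mono)

lemma resample_le_const: "(\<And>w. F w \<le> c) \<Longrightarrow> resample p xs F w \<le> c"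
  using resample_mono[of F "\<lambda>_. c"] by simp

lemma resample_increasing:
  assumes "\<And>w w'. w \<le> w' \<Longrightarrow> F w \<le> F w'" "w \<le> w'"
  shows "resample p xs F w \<le> resample p xs F w'"
  using assms(2)
proof (induction xs arbitrary: w w')
  case (Cons v vs)
  then have "w(v := b) \<le> w'(v := b)" for b by (auto simp: le_fun_def)
  then show ?case using Cons p by (auto intro!: add_mono mult_left_mono)
qed (use assms in auto)

text \<open>One site at a time: shifting weight to the open value helps, since an increasing
  \<open>F\<close> is larger there. This carries bounds at \<open>p0\<close> over to smaller
  \<open>p\<close>.\<close>

lemma resample_mono_prob:
  assumes F: "\<And>w w'. w \<le> w' \<Longrightarrow> F w \<le> F w'" and p': "p \<le> p'" "p' \<le> 1"
  shows "resample p xs F w \<le> resample p' xs F w"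
proof (induction xs arbitrary: w)
  case (Cons v vs)
  let ?a = "resample p vs F (w(v := True))" and ?b = "resample p vs F (w(v := False))"
  have "?b \<le> ?a" by (rule resample_increasing[OF F]) (auto simp: le_fun_def)
  then have "0 \<le> (p' - p) * (?a - ?b)" using p' by simp
  then have "p * ?a + (1 - p) * ?b \<le> p' * ?a + (1 - p') * ?b" by (simp add: algebra_simps)
  also have "\<dots> \<le> p' * resample p' vs F (w(v := True)) + (1 - p') * resample p' vs F (w(v := False))"
    using Cons p p' by (intro add_mono mult_left_mono) auto
  finally show ?case by simp
qed simp

end

section \<open>Expected change of the potential across one row\<close>

lemma resample_next_row:
  "resample p [r - int (length l) + 1..r] (\<lambda>g. f (next_row g r l)) g = row_exp p (1 - p) l f"
proof (induction l arbitrary: r f g)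
  case (Cons c l)
  let ?h = "\<lambda>n. if c \<or> hd1 l \<or> hd1 n then p * f (True # n) + (1 - p) * f (False # n)
      else (p + (1 - p)) * f (False # n)"
  have "next_row (g(r := b)) (r - 1) l = next_row g (r - 1) l" for g b
    by (rule next_row_cong) auto
  then have "resample p [r] (\<lambda>g. f (next_row g r (c # l))) = (\<lambda>g. ?h (next_row g (r - 1) l))"
    by (simp add: Let_def algebra_simps fun_eq_iff)
  \<comment> \<open>Sites are drawn from left to right, so \<open>r\<close> is innermost, matching
    the recursion of \<open>row_exp\<close>.\<close>
  moreover have "[r - int (length (c # l)) + 1..r] = [(r - 1) - int (length l) + 1..r - 1] @ [r]"
    by (subst upto_rec2) auto
  ultimately show ?case
    by (simp only: resample_append row_exp.simps Cons.IH[of "r - 1" ?h])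
qed simp

text \<open>Induction on the distance to the cap \<open>B\<close>, with \<open>run_weights\<close>
  as the supersolution.\<close>

lemma resample_extend:
  assumes "B \<le> N"
  shows "resample p0 [x + 1..N] (\<lambda>g. val (extend g (nat (B - x)) x (True # n))) g
     \<le> (256 / 255) powi x * real_of_int (look run_weights n)"
proof (induction "nat (B - x)" arbitrary: x n g)
  case 0
  then show ?case using look_run(1)[of n] by (simp flip: 0 add: val_def)
next
  case (Suc k)
  then have k: "k = nat (B - (x + 1))" and x: "x + 1 \<le> N" using assms by auto
  let ?F = "\<lambda>g. val (extend g (Suc k) x (True # n))"
  let ?z = "(256 / 255) powi x :: real"
  have "resample p0 [x + 1 + 1..N] ?F (g(x + 1 := True))
      = resample p0 [x + 1 + 1..N] (\<lambda>g. val (extend g (nat (B - (x + 1))) (x + 1) (True # True # n))) (g(x + 1 := True))"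
    by (rule resample_cong) (simp add: k)
  also have "\<dots> \<le> (256 / 255) powi (x + 1) * real_of_int (look run_weights (True # n))"
    by (rule Suc(1)[OF k])
  finally have 1: "resample p0 [x + 1 + 1..N] ?F (g(x + 1 := True))
      \<le> ?z * (256 / 255 * real_of_int (look run_weights (True # n)))"
    by (simp add: power_int_add)
  have "resample p0 [x + 1 + 1..N] ?F (g(x + 1 := False))
      = resample p0 [x + 1 + 1..N] (\<lambda>_. val (x, True # n)) (g(x + 1 := False))"
    by (rule resample_cong) simp
  then have 2: "resample p0 [x + 1 + 1..N] ?F (g(x + 1 := False)) = ?z * real_of_int (look weights n)"
    by (simp add: val_def)
  have "resample p0 [x + 1..N] ?F g \<le> p0 * (?z * (256 / 255 * real_of_int (look run_weights (True # n))))
      + (1 - p0) * (?z * real_of_int (look weights n))"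
    unfolding upto_rec1[OF x] resample.simps 2 using 1 by (intro add_mono mult_left_mono) auto
  also have "\<dots> = ?z * (p0 * (256 / 255) * real_of_int (look run_weights (True # n))
      + (1 - p0) * real_of_int (look weights n))"
    by (simp add: algebra_simps)
  also have "\<dots> \<le> ?z * real_of_int (look run_weights n)"
    by (intro mult_left_mono look_run(2)) simp
  finally show ?case unfolding Suc(2) .
qed

abbreviation \<kappa> :: real where "\<kappa> \<equiv> 32767 / 32768"

text \<open>The factor \<open>256 / 255\<close> follows the diagonal: in the new row the reference
  position is \<open>r + 1\<close>, and relative to it the potential contracts by \<kappa>.\<close>

lemma resample_step:
  assumes l: "length l = 6" "hd1 l" and N: "- N \<le> r - 6" "r + 1 \<le> N" "B \<le> N"
  shows "resample p0 [-N..N] (\<lambda>g. val (trim (advance g B (r, l)))) g \<le> \<kappa> * (256 / 255) * val (r, l)"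
proof -
  let ?F = "\<lambda>g. val (trim (advance g B (r, l)))"
  let ?z = "(256 / 255) powi (r + 1) :: real"
  have p0: "0 \<le> p0" "p0 \<le> 1" by simp_all
  \<comment> \<open>Far-left sites are forgotten, the next six determine \<open>next_row\<close>,
    and those ahead determine the run.\<close>
  have split: "[-N..N] = [-N..r - 6] @ [r - 5..r] @ [r + 1..N]"
  proof -
    have "[-N..N] = [-N..r - 6] @ [r - 6 + 1..N]"
      by (rule upto_split2) (use N in auto)
    moreover have "[r - 5..N] = [r - 5..r] @ [r + 1..N]"
      by (rule upto_split2) (use N in auto)
    ultimately show ?thesis by simp
  qed
  have ahead: "resample p0 [r + 1..N] ?F g \<le> ?z * final (next_row g r l)" for g
  proof -
    let ?n = "next_row g r l"
    have "resample p0 [r + 1 + 1..N] ?F (g(r + 1 := True))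
        = resample p0 [r + 1 + 1..N]
            (\<lambda>g. val (extend g (nat (B - (r + 1))) (r + 1) (True # ?n))) (g(r + 1 := True))"
    proof (rule resample_cong)
      fix g'
      assume g': "\<And>v. v \<notin> set [r + 1 + 1..N] \<Longrightarrow> g' v = (g(r + 1 := True)) v"
      then have "g' (r + 1) = True" by simp
      moreover have "next_row g' r l = ?n"
        by (rule next_row_cong) (use g' in auto)
      ultimately show "?F g' = val (extend g' (nat (B - (r + 1))) (r + 1) (True # ?n))"
        by (simp add: advance_def val_trim)
    qed
    also have "\<dots> \<le> ?z * real_of_int (look run_weights ?n)"
      by (rule resample_extend) (use N in simp)
    finally have 1: "resample p0 [r + 1 + 1..N] ?F (g(r + 1 := True))
        \<le> ?z * real_of_int (look run_weights ?n)" .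
    have "resample p0 [r + 1 + 1..N] ?F (g(r + 1 := False))
        = resample p0 [r + 1 + 1..N] (\<lambda>_. val (r, ?n)) (g(r + 1 := False))"
    proof (rule resample_cong)
      fix g'
      assume g': "\<And>v. v \<notin> set [r + 1 + 1..N] \<Longrightarrow> g' v = (g(r + 1 := False)) v"
      then have "g' (r + 1) = False" by simp
      moreover have "next_row g' r l = ?n"
        by (rule next_row_cong) (use g' in auto)
      ultimately show "?F g' = val (r, ?n)"
        by (simp add: advance_def val_trim)
    qed
    then have 2: "resample p0 [r + 1 + 1..N] ?F (g(r + 1 := False)) = ?z * (255 / 256 * pot ?n)"
      by (simp add: val_def power_int_add)
    have "resample p0 [r + 1..N] ?F g \<le> p0 * (?z * real_of_int (look run_weights ?n))
        + (1 - p0) * (?z * (255 / 256 * pot ?n))"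
      unfolding upto_rec1[OF N(2)] resample.simps 2 using 1 by (intro add_mono mult_left_mono) auto
    then show ?thesis by (simp add: final_def algebra_simps)
  qed
  have "resample p0 ([r - 5..r] @ [r + 1..N]) ?F g \<le> \<kappa> * (256 / 255) * val (r, l)" for g
  proof -
    obtain m where m: "l = True # m" "length m = 5"
      using l by (cases l) auto
    have "resample p0 ([r - 5..r] @ [r + 1..N]) ?F g
        \<le> resample p0 [r - 5..r] (\<lambda>g. ?z * final (next_row g r l)) g"
      unfolding resample_append by (intro resample_mono ahead p0)
    also have "\<dots> = ?z * row_exp p0 (1 - p0) l final"
      using resample_next_row[of p0 r l final g] l by (simp add: resample_cmult)
    also have "\<dots> \<le> ?z * (\<kappa> * real_of_int (look weights m))"
      unfolding m(1) by (intro mult_left_mono row_exp_final m) simp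
    finally show ?thesis by (simp add: m val_def power_int_add mult.commute)
  qed
  then show ?thesis
    unfolding split by (subst resample_append) (rule resample_le_const[OF p0])
qed

section \<open>Iterating the one-row estimate\<close>

lemma advance_bounds:
  assumes "advance g B (r, l) = (x, n)"
  shows "r \<le> x" "x \<le> max (r + 1) B" "length n = length l + nat (x - r)"
proof -
  have ext: "y \<le> fst (extend g k y m) \<and> fst (extend g k y m) \<le> y + int k \<and>
      length (snd (extend g k y m)) = length m + nat (fst (extend g k y m) - y)" for k y m
    by (induction g k y m rule: extend.induct) (auto simp: nat_add_distrib)
  have "r \<le> x \<and> x \<le> max (r + 1) B \<and> length n = length l + nat (x - r)"
    using assms ext[of "r + 1" "nat (B - (r + 1))" "True # next_row g r l"]
    by (auto simp: advance_def Let_def split: if_splits)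
  then show "r \<le> x" "x \<le> max (r + 1) B" "length n = length l + nat (x - r)" by auto
qed

text \<open>A row has six entries plus \<open>x - r\<close> new ones, so \<open>strip\<close>
  retreats at most to \<open>r - 6\<close>. Once the edge is at or past \<open>B\<close>, a row
  advances it by at most one.\<close>

lemma explore_bounds:
  assumes "0 \<le> B"
  shows "fst (explore w B y) \<le> B + int y" "- 6 * int y \<le> fst (explore w B y)"
proof (induction y)
  case (Suc y)
  {
    case 1
    obtain r l x n where s: "explore w B y = (r, l)" "advance (\<lambda>x. w (x, int y)) B (r, l) = (x, n)"
      by (metis surj_pair)
    then show ?case
      using Suc advance_bounds[OF s(2)] strip_bounds[of x n] length_explore[of w B y]
      by (auto simp: trim_def split: prod.splits)
  next
    case 2
    obtain r l x n where s: "explore w B y = (r, l)" "advance (\<lambda>x. w (x, int y)) B (r, l) = (x, n)"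
      by (metis surj_pair)
    then show ?case
      using Suc advance_bounds[OF s(2)] strip_bounds[of x n] length_explore[of w B y]
      by (auto simp: trim_def split: prod.splits)
  }
qed (use assms in auto)

definition row_sites :: "int \<Rightarrow> nat \<Rightarrow> (int \<times> int) list" where
  "row_sites N y = map (\<lambda>x. (x, int y)) [-N..N]"

lemma explore_cong:
  "(\<And>x z. z < y \<Longrightarrow> w (x, int z) = w' (x, int z)) \<Longrightarrow> explore w B y = explore w' B y"
proof (induction y)
  case (Suc y)
  then have "(\<lambda>x. w (x, int y)) = (\<lambda>x. w' (x, int y))" by auto
  then show ?case using Suc by simp
qed simp

text \<open>The newest row is drawn innermost; earlier rows fix the state, so the one-row bound
  applies conditionally. \<open>10 ^ 6\<close> is the weight of the full initial window.\<close>

lemma resample_explore: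
  assumes B: "0 \<le> B" and N: "B + 6 * int y + 6 \<le> N"
  shows "resample p0 (concat (map (row_sites N) [0..<y])) (\<lambda>w. val (explore w B y)) w
    \<le> 10 ^ 6 * (\<kappa> * (256 / 255)) ^ y"
  using N
proof (induction y arbitrary: w)
  case 0
  then show ?case
    using weights_bounds(2) by (simp add: val_def pot_pad numeral_eq_Suc)
next
  case (Suc y)
  have p0: "0 \<le> p0" "p0 \<le> 1" by simp_all
  let ?c = "\<kappa> * (256 / 255) :: real"
  have *: "resample p0 (row_sites N y) (\<lambda>w. val (explore w B (Suc y))) w \<le> ?c * val (explore w B y)" for w
  proof -
    obtain r l where s: "explore w B y = (r, l)" by force
    let ?G = "\<lambda>g. val (trim (advance g B (r, l)))"
    let ?row = "\<lambda>x. (x, int y)"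
    have "resample p0 (row_sites N y) (\<lambda>w. val (explore w B (Suc y))) w
        = resample p0 (row_sites N y) (\<lambda>w. ?G (w \<circ> ?row)) w"
    proof (rule resample_cong)
      fix w' assume w': "\<And>v. v \<notin> set (row_sites N y) \<Longrightarrow> w' v = w v"
      have "explore w' B y = explore w B y"
        by (rule explore_cong, rule w') (auto simp: row_sites_def)
      then show "val (explore w' B (Suc y)) = ?G (w' \<circ> ?row)"
        by (simp add: s comp_def)
    qed
    also have "\<dots> = resample p0 [-N..N] ?G (w \<circ> ?row)"
      unfolding row_sites_def by (rule resample_map) (auto simp: inj_def)
    also have "\<dots> \<le> ?c * val (r, l)"
      using explore_bounds[OF B, where w = w and y = y] length_explore[of w B y] hd1_explore[of w B y] s Suc.prems B
      by (intro resample_step) auto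
    finally show ?thesis by (simp add: s)
  qed
  have "resample p0 (concat (map (row_sites N) [0..<Suc y])) (\<lambda>w. val (explore w B (Suc y))) w
      \<le> resample p0 (concat (map (row_sites N) [0..<y])) (\<lambda>w. ?c * val (explore w B y)) w"
    by (simp only: upt_Suc_append[OF le0] map_append concat_append resample_append list.map concat.simps append_Nil2)
      (intro resample_mono p0 *)
  also have "\<dots> \<le> ?c * (10 ^ 6 * ?c ^ y)"
    unfolding resample_cmult using Suc.prems by (intro mult_left_mono Suc.IH) auto
  finally show ?case by (simp add: mult.commute mult.left_commute)
qed

text \<open>Markov's inequality: reaching \<open>(u, int y)\<close> puts the edge at or beyond
  \<open>u\<close>, and \<open>997157\<close> is the least weight. The cap is
  \<open>B = u\<close>.\<close>

lemma resample_reach: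
  fixes u :: int and y :: nat
  assumes u: "int y \<le> u" and p: "0 \<le> p" "p \<le> p0"
  shows "\<exists>vs. \<forall>w. resample p vs (\<lambda>w. of_bool (\<exists>N. reach N w (u, int y))) w \<le> 2 * \<kappa> ^ nat u"
proof (intro exI allI)
  fix w
  let ?vs = "concat (map (row_sites (u + 6 * int (Suc y) + 6)) [0..<Suc y])"
  let ?F = "\<lambda>w. of_bool (\<exists>N. reach N w (u, int y)) :: real"
  let ?c = "\<kappa> * (256 / 255) :: real"
  have u0: "0 \<le> u" using u by simp
  have "resample p ?vs ?F w \<le> resample p0 ?vs ?F w"
    using p by (intro resample_mono_prob) (auto intro: reach_mono)
  also have "\<dots> \<le> resample p0 ?vs (\<lambda>w. (255 / 256) ^ nat u / 997157 * val (explore w u (Suc y))) w"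
  proof (rule resample_mono)
    fix w
    have v: "0 \<le> val s" for s
      using pot_pos by (auto simp: val_def split: prod.splits intro: less_imp_le)
    show "?F w \<le> (255 / 256) ^ nat u / 997157 * val (explore w u (Suc y))"
    proof (cases "\<exists>N. reach N w (u, int y)")
      case True
      obtain r l where s: "explore w u (Suc y) = (r, l)" by force
      have "u \<in> occ r l"
        using True reach_explored[of _ w u y u] s
          occ_trim[of "advance (\<lambda>x. w (x, int y)) u (explore w u y)"] by auto
      then have "u \<le> r" by (rule occ_le)
      have "length l = 6" "hd1 l"
        using hd1_explore[of w u "Suc y"] length_explore[of w u "Suc y"] unfolding s by simp_all
      then obtain m where m: "l = True # m" by (cases l) auto
      have "(256 / 255) ^ nat u * 997157 \<le> val (r, l)"
      proof -
        have "(256 / 255 :: real) ^ nat u = (256 / 255) powi u"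
          using u0 by (simp add: power_int_def)
        also have "\<dots> \<le> (256 / 255) powi r"
          using \<open>u \<le> r\<close> by (intro power_int_increasing) auto
        finally show ?thesis
          using weights_bounds(1)[of m] unfolding val_def m by (auto intro!: mult_mono)
      qed
      then have "(255 / 256) ^ nat u / 997157 * ((256 / 255) ^ nat u * 997157)
          \<le> (255 / 256) ^ nat u / 997157 * val (explore w u (Suc y))"
        unfolding s by (intro mult_left_mono) auto
      moreover have "(255 / 256 :: real) ^ nat u * (256 / 255) ^ nat u = 1"
        by (simp flip: power_mult_distrib)
      ultimately show ?thesis using True by (simp add: field_simps)
    qed (simp add: v)
  qed simp_all
  also have "\<dots> \<le> (255 / 256) ^ nat u / 997157 * (10 ^ 6 * ?c ^ Suc y)"
    unfolding resample_cmult using u0 by (intro mult_left_mono resample_explore) auto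
  \<comment> \<open>Since \<open>?c\<close> exceeds 1 and \<open>int y \<le> u\<close>, the exponent
    may be raised.\<close>
  also have "\<dots> \<le> (255 / 256) ^ nat u / 997157 * (10 ^ 6 * ?c ^ Suc (nat u))"
    using u by (intro mult_left_mono power_increasing) auto
  also have "\<dots> = (10 ^ 6 * ?c / 997157) * ((255 / 256) ^ nat u * ?c ^ nat u)"
    by simp
  also have "(255 / 256) ^ nat u * ?c ^ nat u = \<kappa> ^ nat u"
    by (simp flip: power_mult_distrib)
  \<comment> \<open>The prefactor is about 1.007.\<close>
  also have "(10 ^ 6 * ?c / 997157) * \<kappa> ^ nat u \<le> 2 * \<kappa> ^ nat u"
    by (intro mult_right_mono) auto
  finally show "resample p ?vs ?F w \<le> 2 * \<kappa> ^ nat u" .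
qed

subsection \<open>The site measure\<close>

lemma prob_space_site_measure: "prob_space (site_measure p)"
  unfolding site_measure_def by (intro prob_space_PiM measure_pmf.prob_space_axioms)

lemma space_site_measure [simp]: "space (site_measure p) = UNIV"
  by (simp add: site_measure_def space_PiM)

lemma measurable_site [measurable]: "Measurable.pred (site_measure p) (\<lambda>w. w v)"
  using measurable_component_singleton[of v UNIV "\<lambda>_. measure_pmf (bernoulli_pmf p)"]
  by (auto simp: site_measure_def measurable_def)

lemma measurable_fun_upd_site [measurable]:
  "(\<lambda>w. w(v := b)) \<in> measurable (site_measure p) (site_measure p)"
  unfolding site_measure_def fun_upd_def
proof (rule measurable_PiM_single')
  fix i :: "int \<times> int"
  let ?M = "\<lambda>_ :: int \<times> int. measure_pmf (bernoulli_pmf p)"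
  show "(\<lambda>w. if i = v then b else w i) \<in> measurable (Pi\<^sub>M UNIV ?M) (?M i)"
    using measurable_component_singleton[of i UNIV ?M] by (cases "i = v") simp_all
qed (auto simp: space_PiM)

lemma site_measure_resample:
  "distr (measure_pmf (bernoulli_pmf p) \<Otimes>\<^sub>M site_measure p) (site_measure p) (\<lambda>(b, w). w(v := b))
     = site_measure p"
  \<comment> \<open>\<open>UNIV\<close> already contains \<open>v\<close>, so the inserted
    coordinate overwrites an old one.\<close>
  using distr_pair_PiM_eq_PiM[where I = UNIV and M = "\<lambda>_. measure_pmf (bernoulli_pmf p)" and i' = v]
  unfolding site_measure_def by (simp add: measure_pmf.prob_space_axioms)

context
  fixes p :: real
  assumes p: "0 \<le> p" "p \<le> 1"
begin

interpretation prob_space "site_measure p" by (rule prob_space_site_measure)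

lemma measurable_resample:
  "F \<in> borel_measurable (site_measure p) \<Longrightarrow> resample p vs F \<in> borel_measurable (site_measure p)"
proof (induction vs)
  case (Cons v vs)
  then have [measurable]: "resample p vs F \<in> borel_measurable (site_measure p)" by simp
  have "resample p (v # vs) F = (\<lambda>w. p * resample p vs F (w(v := True)) + (1 - p) * resample p vs F (w(v := False)))"
    by (simp add: fun_eq_iff)
  then show ?case by simp
next
  case Nil
  moreover have "resample p [] F = F" by (simp add: fun_eq_iff)
  ultimately show ?case by simp
qed

lemma resample_abs_le:
  assumes "\<And>w. \<bar>F w\<bar> \<le> c"
  shows "\<bar>resample p vs F w\<bar> \<le> c"
proof -
  have "resample p vs F w \<le> c"
    by (rule resample_le_const[OF p]) (meson assms abs_le_D1)
  moreover have "- c \<le> resample p vs F w"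
    using resample_mono[OF p, of "\<lambda>_. - c" F vs w] assms by (simp add: abs_le_iff minus_le_iff)
  ultimately show ?thesis by linarith
qed

lemma expectation_resample_site:
  assumes F [measurable]: "F \<in> borel_measurable (site_measure p)" and bd: "\<And>w. \<bar>F w\<bar> \<le> c"
  shows "expectation (\<lambda>w. p * F (w(v := True)) + (1 - p) * F (w(v := False))) = expectation F"
proof -
  let ?P = "measure_pmf (bernoulli_pmf p)"
  interpret pair_sigma_finite ?P "site_measure p"
    by (rule pair_sigma_finite.intro) unfold_locales
  interpret P: pair_prob_space ?P "site_measure p" by unfold_locales
  have [measurable]: "(\<lambda>(b, w). w(v := b)) \<in> measurable (?P \<Otimes>\<^sub>M site_measure p) (site_measure p)"
    unfolding site_measure_def case_prod_beta by (rule measurable_fun_upd[where J = UNIV]) auto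
  have int: "integrable (?P \<Otimes>\<^sub>M site_measure p) (\<lambda>(b, w). F (w(v := b)))"
    by (rule P.integrable_const_bound[where B = c]) (use bd in auto)
  have "expectation F = integral\<^sup>L (distr (?P \<Otimes>\<^sub>M site_measure p) (site_measure p) (\<lambda>(b, w). w(v := b))) F"
    by (simp only: site_measure_resample)
  also have "\<dots> = (\<integral>x. (\<lambda>(b, w). F (w(v := b))) x \<partial>(?P \<Otimes>\<^sub>M site_measure p))"
    by (subst integral_distr) (auto intro!: Bochner_Integration.integral_cong)
  also have "\<dots> = (\<integral>b. (\<integral>w. F (w(v := b)) \<partial>site_measure p) \<partial>?P)"
    using integral_fst'[OF int] by simp
  also have "\<dots> = p * (\<integral>w. F (w(v := True)) \<partial>site_measure p) + (1 - p) * (\<integral>w. F (w(v := False)) \<partial>site_measure p)"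
    using p by (simp add: integral_bernoulli_pmf)
  also have "\<dots> = expectation (\<lambda>w. p * F (w(v := True)) + (1 - p) * F (w(v := False)))"
  proof -
    have "integrable (site_measure p) (\<lambda>w. F (w(v := b)))" for b
      by (rule integrable_const_bound[where B = c]) (use bd in auto)
    then show ?thesis by simp
  qed
  finally show ?thesis by simp
qed

lemma expectation_resample:
  assumes F: "F \<in> borel_measurable (site_measure p)" and bd: "\<And>w. \<bar>F w\<bar> \<le> c"
  shows "expectation (resample p vs F) = expectation F"
proof (induction vs)
  case (Cons v vs)
  have "resample p (v # vs) F = (\<lambda>w. p * resample p vs F (w(v := True)) + (1 - p) * resample p vs F (w(v := False)))"
    by (simp add: fun_eq_iff)
  then show ?case
    using expectation_resample_site[OF measurable_resample[OF F] resample_abs_le[OF bd]] Cons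
    by simp
qed (simp add: fun_eq_iff)

text \<open>Bridge from finite sums to the measure: resampling preserves expectations, so a bound
  uniform in the untouched sites bounds the probability.\<close>

lemma prob_le_resample:
  assumes Q [measurable]: "Measurable.pred (site_measure p) Q"
    and bd: "\<And>w. resample p vs (\<lambda>w. of_bool (Q w)) w \<le> c"
  shows "prob {w. Q w} \<le> c"
proof -
  let ?F = "\<lambda>w. of_bool (Q w) :: real"
  have F [measurable]: "?F \<in> borel_measurable (site_measure p)" by measurable
  have b: "\<bar>?F w\<bar> \<le> 1" for w by simp
  have "{w. Q w} \<in> events" using Q by (simp add: pred_def)
  then have "prob {w. Q w} = expectation ?F"
    by (subst Bochner_Integration.integral_cong[where g = "indicator {w. Q w}"]) (auto simp: indicator_def)
  also have "\<dots> = expectation (resample p vs ?F)"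
    using expectation_resample[OF F b] by simp
  also have "\<dots> \<le> expectation (\<lambda>_. c)"
  proof (rule integral_mono)
    show "integrable (site_measure p) (resample p vs ?F)"
      using resample_abs_le[of ?F 1, OF b]
      by (intro integrable_const_bound[where B = 1] measurable_resample F) auto
  qed (use bd in auto)
  also have "\<dots> = c" using prob_space by simp
  finally show ?thesis .
qed

end

subsection \<open>Finiteness of the cluster\<close>

text \<open>Recursion on the last step parallels \<open>reach\<close> and gives measurability by
  induction.\<close>

fun path_to :: "nat \<Rightarrow> (int \<times> int \<Rightarrow> bool) \<Rightarrow> int \<times> int \<Rightarrow> bool" where
  "path_to 0 w v \<longleftrightarrow> v = (0, 0) \<and> w v"
| "path_to (Suc N) w v \<longleftrightarrow> w v \<and> (\<exists>d\<in>{- e1, e2, e2 - e1}. path_to N w (v - d))"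

lemma cluster_eq: "cluster w (0, 0) = {v. \<exists>N. path_to N w v}"
proof -
  have 1: "path_to N w (\<gamma> N)"
    if "\<gamma> 0 = (0, 0)" "\<forall>i\<le>N. w (\<gamma> i)" "\<forall>i<N. \<gamma> (Suc i) - \<gamma> i \<in> {- e1, e2, e2 - e1}" for N \<gamma>
    using that
  proof (induction N)
    case (Suc N)
    define d where "d = \<gamma> (Suc N) - \<gamma> N"
    have "path_to N w (\<gamma> N)" using Suc by simp
    moreover have "\<gamma> N = \<gamma> (Suc N) - d" by (simp add: d_def)
    moreover have "d \<in> {- e1, e2, e2 - e1}" "w (\<gamma> (Suc N))" using Suc.prems by (auto simp: d_def)
    ultimately show ?case unfolding path_to.simps by metis
  qed simp
  have 2: "\<exists>\<gamma>. \<gamma> 0 = (0, 0) \<and> \<gamma> N = v \<and> (\<forall>i\<le>N. w (\<gamma> i)) \<and>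
      (\<forall>i<N. \<gamma> (Suc i) - \<gamma> i \<in> {- e1, e2, e2 - e1})" if "path_to N w v" for N v
    using that
  proof (induction N arbitrary: v)
    case 0
    then show ?case by (intro exI[of _ "\<lambda>_. (0, 0)"]) auto
  next
    case (Suc N)
    from Suc.prems have "w v" "\<exists>d\<in>{- e1, e2, e2 - e1}. path_to N w (v - d)"
      by (simp_all only: path_to.simps)
    then obtain d where d: "d \<in> {- e1, e2, e2 - e1}" "path_to N w (v - d)" "w v"
      by metis
    from Suc.IH[OF d(2)] obtain \<gamma> where \<gamma>: "\<gamma> 0 = (0, 0)" "\<gamma> N = v - d" "\<forall>i\<le>N. w (\<gamma> i)"
      "\<forall>i<N. \<gamma> (Suc i) - \<gamma> i \<in> {- e1, e2, e2 - e1}" by blast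
    let ?\<gamma> = "\<gamma>(Suc N := v)"
    have "\<forall>i\<le>Suc N. w (?\<gamma> i)" using \<gamma>(3) d(3) by (simp add: le_Suc_eq)
    moreover have "?\<gamma> (Suc i) - ?\<gamma> i \<in> {- e1, e2, e2 - e1}" if "i < Suc N" for i
    proof (cases "i = N")
      case True
      then have "?\<gamma> (Suc i) - ?\<gamma> i = d" using \<gamma>(2) by simp
      then show ?thesis using d(1) by (simp only:)
    next
      case False
      then show ?thesis using \<gamma>(4)[rule_format, of i] that by simp
    qed
    ultimately show ?case using \<gamma>(1) by (intro exI[of _ ?\<gamma>] conjI) simp_all
  qed
  show ?thesis
  proof (intro set_eqI iffI)
    fix v assume "v \<in> cluster w (0, 0)"
    then obtain N \<gamma> where "\<gamma> N = v" "\<gamma> 0 = (0, 0)" "\<forall>i\<le>N. w (\<gamma> i)"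
      "\<forall>i<N. \<gamma> (Suc i) - \<gamma> i \<in> {- e1, e2, e2 - e1}"
      unfolding cluster_def by (elim CollectE exE conjE)
    then show "v \<in> {v. \<exists>N. path_to N w v}" using 1[of \<gamma> N] by auto
  next
    fix v assume "v \<in> {v. \<exists>N. path_to N w v}"
    then obtain N where "path_to N w v" by blast
    from 2[OF this] obtain \<gamma> where "\<gamma> 0 = (0, 0)" "\<gamma> N = v" "\<forall>i\<le>N. w (\<gamma> i)"
      "\<forall>i<N. \<gamma> (Suc i) - \<gamma> i \<in> {- e1, e2, e2 - e1}" by (elim exE conjE)
    then show "v \<in> cluster w (0, 0)"
      unfolding cluster_def by (intro CollectI exI[of _ N] exI[of _ \<gamma>] conjI)
  qed
qed

lemma measurable_path_to [measurable]: "Measurable.pred (site_measure p) (\<lambda>w. path_to N w v)"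
  by (induction N arbitrary: v) simp_all

text \<open>Both maps carry the steps onto \<open>(1, 0)\<close>, \<open>(0, 1)\<close>,
  \<open>(1, 1)\<close>. The second also exchanges the coordinates, because
  \<open>resample_reach\<close> covers only targets on or below the diagonal.\<close>

lemma path_to_reach:
  assumes "path_to N w (i, j)"
  shows "reach N (w \<circ> (\<lambda>(x, y). (- x, y))) (- i, j) \<and> reach N (w \<circ> (\<lambda>(x, y). (- y, x))) (j, - i)"
  using assms
proof (induction N arbitrary: i j)
  case (Suc N)
  define a b where "a = w \<circ> (\<lambda>(x, y). (- x, y))" and "b = w \<circ> (\<lambda>(x, y). (- y, x))"
  have "path_to N w (i + 1, j) \<or> path_to N w (i, j - 1) \<or> path_to N w (i + 1, j - 1)"
    using Suc.prems by (auto simp: e1_def e2_def)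
  then have "reach N a (- i - 1, j) \<and> reach N b (j, - i - 1)
      \<or> reach N a (- i, j - 1) \<and> reach N b (j - 1, - i)
      \<or> reach N a (- i - 1, j - 1) \<and> reach N b (j - 1, - i - 1)"
    using Suc.IH[of "i + 1" j] Suc.IH[of i "j - 1"] Suc.IH[of "i + 1" "j - 1"]
    unfolding a_def[symmetric] b_def[symmetric] by auto
  moreover have "a (- i, j)" "b (j, - i)" using Suc.prems by (simp_all add: a_def b_def)
  ultimately have "reach (Suc N) a (- i, j) \<and> reach (Suc N) b (j, - i)" by auto
  then show ?case unfolding a_def b_def .
qed auto

lemma path_to_quadrant:
  assumes "path_to N w v"
  shows "fst v \<le> 0 \<and> 0 \<le> snd v"
proof -
  have "reach N (w \<circ> (\<lambda>(x, y). (- x, y))) (- fst v, snd v)"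
    using path_to_reach[of N w "fst v" "snd v"] assms by simp
  from reach_nonneg[OF this] show ?thesis by simp
qed

lemma prob_path_to:
  assumes p: "0 \<le> p" "p \<le> p0"
  shows "measure (site_measure p) {w. \<exists>N. path_to N w v} \<le> 2 * \<kappa> ^ nat (max (- fst v) (snd v))"
proof (cases "fst v \<le> 0 \<and> 0 \<le> snd v")
  case False
  have "\<not> path_to N w v" for N w
    using path_to_quadrant[of N w v] False by blast
  then show ?thesis by simp
next
  case True
  have p1: "p \<le> 1" using p by simp
  \<comment> \<open>The bound is transported along \<open>\<phi>\<close> by resampling the images
    under \<open>\<phi>\<close> of the sites used for \<open>reach\<close>.\<close>
  have main: ?thesis
    if \<phi>: "inj \<phi>" and u: "int y \<le> u" and path: "\<And>N w. path_to N w v \<Longrightarrow> reach N (w \<circ> \<phi>) (u, int y)"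
      and max: "u = max (- fst v) (snd v)" for \<phi> u y
  proof -
    obtain vs where vs: "\<And>w. resample p vs (\<lambda>w. of_bool (\<exists>N. reach N w (u, int y))) w \<le> 2 * \<kappa> ^ nat u"
      using resample_reach[OF u p] by blast
    show ?thesis unfolding max[symmetric]
    proof (rule prob_le_resample[OF p(1) p1])
      fix w
      have "resample p (map \<phi> vs) (\<lambda>w. of_bool (\<exists>N. path_to N w v)) w
          \<le> resample p (map \<phi> vs) (\<lambda>w. of_bool (\<exists>N. reach N (w \<circ> \<phi>) (u, int y))) w"
        by (rule resample_mono[OF p(1) p1]) (auto dest: path)
      also have "\<dots> = resample p vs (\<lambda>w. of_bool (\<exists>N. reach N w (u, int y))) (w \<circ> \<phi>)"
        by (rule resample_map[OF \<phi>])
      also have "\<dots> \<le> 2 * \<kappa> ^ nat u" by (rule vs)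
      finally show "resample p (map \<phi> vs) (\<lambda>w. of_bool (\<exists>N. path_to N w v)) w \<le> 2 * \<kappa> ^ nat u" .
    qed measurable
  qed
  show ?thesis
  proof (cases "snd v \<le> - fst v")
    case le: True
    show ?thesis
      by (rule main[of "\<lambda>(x, y). (- x, y)" "nat (snd v)" "- fst v"])
        (use True le path_to_reach[of _ _ "fst v" "snd v"] in \<open>auto simp: inj_def\<close>)
  next
    case False
    show ?thesis
      by (rule main[of "\<lambda>(x, y). (- y, x)" "nat (- fst v)" "snd v"])
        (use True False path_to_reach[of _ _ "fst v" "snd v"] in \<open>auto simp: inj_def\<close>)
  qed
qed

section \<open>Shells and the Borel-Cantelli argument\<close>

definition shell :: "nat \<Rightarrow> (int \<times> int) set" where
  "shell k = {v. fst v \<le> 0 \<and> 0 \<le> snd v \<and> max (- fst v) (snd v) = int k}"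

lemma shell_subset: "shell k \<subseteq> {- int k..0} \<times> {0..int k}"
  by (auto simp: shell_def)

lemma finite_shell: "finite (shell k)"
  by (rule finite_subset[OF shell_subset]) simp

lemma card_shell: "card (shell k) \<le> (k + 1) ^ 2"
proof -
  have "card (shell k) \<le> card ({- int k..0} \<times> {0..int k})"
    by (rule card_mono[OF _ shell_subset]) simp
  also have "\<dots> = (k + 1) ^ 2" by (simp add: card_cartesian_product power2_eq_square nat_add_distrib)
  finally show ?thesis .
qed

lemma path_to_shell:
  assumes "path_to N w v"
  shows "\<exists>k. v \<in> shell k"
proof -
  have "fst v \<le> 0" "0 \<le> snd v"
    using path_to_quadrant[OF assms] by auto
  then have "v \<in> shell (nat (max (- fst v) (snd v)))" by (auto simp: shell_def)
  then show ?thesis ..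
qed

text \<open>Shells are finite, so an infinite cluster meets shells of arbitrarily large index. This
  form yields measurability and suits Borel-Cantelli.\<close>

lemma infinite_cluster_iff:
  "infinite (cluster w (0, 0)) \<longleftrightarrow> (\<forall>n. \<exists>k\<ge>n. \<exists>v\<in>shell k. \<exists>N. path_to N w v)"
proof
  assume inf: "infinite (cluster w (0, 0))"
  show "\<forall>n. \<exists>k\<ge>n. \<exists>v\<in>shell k. \<exists>N. path_to N w v"
  proof (rule ccontr)
    assume "\<not> ?thesis"
    then obtain n where n: "\<And>k v N. n \<le> k \<Longrightarrow> v \<in> shell k \<Longrightarrow> \<not> path_to N w v" by blast
    have "cluster w (0, 0) \<subseteq> (\<Union>k<n. shell k)"
    proof
      fix v assume "v \<in> cluster w (0, 0)"
      then obtain N where N: "path_to N w v" by (auto simp: cluster_eq)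
      obtain k where k: "v \<in> shell k" using path_to_shell[OF N] by blast
      then have "k < n" using n[of k v N] N by (cases "k < n") auto
      then show "v \<in> (\<Union>k<n. shell k)" using k by blast
    qed
    then show False using inf finite_subset finite_shell by blast
  qed
next
  assume unb: "\<forall>n. \<exists>k\<ge>n. \<exists>v\<in>shell k. \<exists>N. path_to N w v"
  show "infinite (cluster w (0, 0))"
  proof
    assume "finite (cluster w (0, 0))"
    then have "finite ((\<lambda>v. nat (max (- fst v) (snd v))) ` cluster w (0, 0))" by simp
    then obtain b where b: "\<And>v. v \<in> cluster w (0, 0) \<Longrightarrow> nat (max (- fst v) (snd v)) \<le> b"
      by (auto simp: finite_nat_set_iff_bounded_le)
    obtain k v N where "Suc b \<le> k" "v \<in> shell k" "path_to N w v" using unb by blast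
    then show False using b[of v] by (auto simp: cluster_eq shell_def)
  qed
qed

lemma measurable_infinite_cluster [measurable]:
  "Measurable.pred (site_measure p) (\<lambda>w. infinite (cluster w (0, 0)))"
  unfolding infinite_cluster_iff using countable_finite[OF finite_shell] by measurable

lemma prob_infinite_cluster_zero:
  assumes p: "0 \<le> p" "p \<le> p0"
  shows "\<P>(w in site_measure p. infinite (cluster w (0, 0))) = 0"
proof -
  interpret prob_space "site_measure p" by (rule prob_space_site_measure)
  define A where "A k = {w. \<exists>v\<in>shell k. \<exists>N. path_to N w v}" for k
  have ev: "{w. \<exists>N. path_to N w v} \<in> events" for v
  proof -
    have "Measurable.pred (site_measure p) (\<lambda>w. \<exists>N. path_to N w v)" by measurable
    then show ?thesis by (simp add: pred_def)
  qed
  have A_eq: "A k = (\<Union>v\<in>shell k. {w. \<exists>N. path_to N w v})" for k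
    by (auto simp: A_def)
  have A [measurable]: "A k \<in> events" for k
    unfolding A_eq using ev finite_shell by (intro sets.finite_UN) auto
  have bound: "prob (A k) \<le> 2 * ((real k + 1) ^ 2 * \<kappa> ^ k)" for k
  proof -
    have "prob (A k) \<le> (\<Sum>v\<in>shell k. prob {w. \<exists>N. path_to N w v})"
      unfolding A_eq using ev finite_shell by (intro finite_measure_subadditive_finite) auto
    also have "\<dots> \<le> (\<Sum>v\<in>shell k. 2 * \<kappa> ^ k)"
    proof (rule sum_mono)
      fix v assume "v \<in> shell k"
      then have "nat (max (- fst v) (snd v)) = k" by (simp add: shell_def)
      then show "prob {w. \<exists>N. path_to N w v} \<le> 2 * \<kappa> ^ k"
        using prob_path_to[OF p, of v] by simp
    qed
    also have "\<dots> = real (card (shell k)) * (2 * \<kappa> ^ k)" by simp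
    also have "\<dots> \<le> (real k + 1) ^ 2 * (2 * \<kappa> ^ k)"
      using card_shell[of k] by (intro mult_right_mono) (auto simp flip: of_nat_Suc of_nat_power simp: add.commute)
    finally show ?thesis by (simp add: algebra_simps)
  qed
  have "summable (\<lambda>k. (real k + 1) ^ 2 * \<kappa> ^ k)"
  proof (rule summable_comparison_test_bigo)
    \<comment> \<open>A rate strictly between \<kappa> and 1 absorbs the polynomial factor.\<close>
    show "summable (\<lambda>k. norm ((65535 / 65536 :: real) ^ k))" by simp
    show "(\<lambda>k. (real k + 1) ^ 2 * \<kappa> ^ k) \<in> O(\<lambda>k. (65535 / 65536) ^ k)" by real_asymp
  qed
  then have "summable (\<lambda>k. 2 * ((real k + 1) ^ 2 * \<kappa> ^ k))" by (rule summable_mult)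
  then have "summable (\<lambda>k. prob (A k))"
    by (rule summable_comparison_test'[of _ 0]) (use bound in auto)
  then have "AE w in site_measure p. eventually (\<lambda>k. w \<in> space (site_measure p) - A k) sequentially"
    by (intro borel_cantelli_AE1) (auto simp: emeasure_eq_measure)
  then have "AE w in site_measure p. \<not> infinite (cluster w (0, 0))"
    by eventually_elim (auto simp: infinite_cluster_iff eventually_sequentially A_def)
  moreover have "{w. infinite (cluster w (0, 0))} \<in> events"
    using measurable_infinite_cluster[of p] by (simp add: pred_def)
  ultimately show ?thesis by (subst prob_eq_0) auto
qed

text \<open>Supplies a member of the set whose infimum is \<open>critical_prob\<close>, as
  \<open>cInf_greatest\<close> requires. With all sites open, the ray of sites
  \<open>(- int k, 0)\<close> lies in the cluster.\<close>

lemma prob_infinite_cluster_one: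
  "\<P>(w in site_measure 1. infinite (cluster w (0, 0))) = 1"
proof -
  interpret prob_space "site_measure 1" by (rule prob_space_site_measure)
  have "AE w in site_measure 1. w v" for v
    unfolding site_measure_def
    by (rule AE_PiM_component)
      (auto intro: measure_pmf.prob_space_axioms simp: AE_measure_pmf_iff set_pmf_iff, metis pmf_bernoulli_False diff_self zero_le_one order_refl)
  then have "AE w in site_measure 1. \<forall>v. w v" by (simp add: AE_all_countable)
  then have "AE w in site_measure 1. infinite (cluster w (0, 0))"
  proof eventually_elim
    case (elim w)
    have "path_to k w (- int k, 0)" for k
    proof (induction k)
      case (Suc k)
      have "(- int (Suc k), 0) - - e1 = (- int k, 0)" by (simp add: e1_def)
      then have "path_to k w ((- int (Suc k), 0) - - e1)" using Suc by simp
      moreover have "w (- int (Suc k), 0)" using elim by blast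
      ultimately show ?case unfolding path_to.simps by (metis insertI1)
    qed (use elim in simp)
    moreover have "(- int k, 0) \<in> shell k" for k by (simp add: shell_def)
    ultimately show ?case unfolding infinite_cluster_iff by blast
  qed
  moreover have "{w. infinite (cluster w (0, 0))} \<in> events"
    using measurable_infinite_cluster[of 1] by (simp add: pred_def)
  ultimately show ?thesis by (subst prob_eq_1) auto
qed

theorem theorem1p6:
  shows "critical_prob \<ge> 0.5730"
  unfolding critical_prob_def
proof (rule cInf_greatest)
  show "{p. 0 \<le> p \<and> p \<le> 1 \<and> \<P>(w in site_measure p. infinite (cluster w (0, 0))) > 0} \<noteq> {}"
    using prob_infinite_cluster_one by (auto intro!: exI[of _ 1])
next
  fix p :: real
  assume "p \<in> {p. 0 \<le> p \<and> p \<le> 1 \<and> \<P>(w in site_measure p. infinite (cluster w (0, 0))) > 0}"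
  then have "\<not> p \<le> p0" "0 \<le> p" using prob_infinite_cluster_zero[of p] by auto
  \<comment> \<open>\<open>p0\<close> is about 0.57324.\<close>
  then show "0.5730 \<le> p" by simp
qed

end
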